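(* Let $\mathbf{A}\in\mathbb{R}^{N\times N}$ be symmetric with eigenpairs $(\lambda_j,\bm{v}_j)$, where $\bm{v}_1,\dots,\bm{v}_N$ are orthonormal and $1=\lambda_1>|\lambda_2|\ge\cdots\ge|\lambda_N|$. Let $\bm{\widehat{x}}_0\in\mathbb{R}^N$ be a deterministic vector with $\bm{\widehat{x}}_0^\top\bm{v}_1\neq0$, and for $k\ge1$ let $$\bm{\widehat{x}}_{k}=\frac{N}{\mathbb{E}[T]}\mathbf{D}_{\mathcal{T}_k}\mathbf{A}\,\bm{\widehat{x}}_{k-1},$$ where all outcomes of the random variables $T$ and $\mathcal{T}$ appear with equal probability (as specified in the context). Then, for every $k\ge1$, $$\mathbb{E}[\bm{\widehat{x}}_{k}]=\mathbf{A}^k\bm{\widehat{x}}_0.$$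
   Context: For a subset $\mathcal{S}\subseteq\{1,\dots,N\}$, $\mathbf{D}_{\mathcal{S}}=\sum_{i\in\mathcal{S}}\bm{e}_i\bm{e}_i^\top$, where $\bm{e}_i$ is the $i$-th column of the $N\times N$ identity matrix. Random index sets: fix integers $1\le\gamma_1\le\gamma_2\le N$. $T$ is a random integer uniformly distributed on $\{\gamma_1,\dots,\gamma_2\}$, and, given $T$, $\mathcal{T}$ is a uniformly distributed size-$T$ subset of $\{1,\dots,N\}$. The pairs $(T_k,\mathcal{T}_k)$, $k\ge1$, are independent and identically distributed copies of $(T,\mathcal{T})$. *)

theory Defs
  imports "HOL-Probability.Probability"
begin

definition index_selection :: "'n::finite set \<Rightarrow> real^'n^'n" where
  "index_selection S =
     (\<Sum>i\<in>S. (columnvector (axis i 1) :: real^1^'n) ** (rowvector (axis i 1) :: real^'n^1))"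

(* Joint law of a random size and a random index set of that size.  It is meant for
   1 \<le> g1 \<le> g2 \<le> CARD('n), when both pmf_of_set arguments are finite and nonempty. *)
definition random_index_set_pmf :: "nat \<Rightarrow> nat \<Rightarrow> (nat \<times> 'n::finite set) pmf" where
  "random_index_set_pmf g1 g2 =
     do { t \<leftarrow> pmf_of_set {g1..g2};
          S \<leftarrow> pmf_of_set {S. card S = t};
          return_pmf (t, S) }"

definition mean_set_size :: "(nat \<times> 'n set) pmf \<Rightarrow> real" where
  "mean_set_size p = measure_pmf.expectation p (\<lambda>(t, S). real t)"

(* The power operation (^) on real^'n^'n is componentwise, hence this definition. *)
primrec matrix_power :: "real^'n^'n \<Rightarrow> nat \<Rightarrow> real^'n^'n" where
  "matrix_power A 0 = mat 1"
| "matrix_power A (Suc k) = A ** matrix_power A k"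

end

theory Submission
  imports Defs
begin

text \<open>
The factor \<open>N / \<bbbE>[T]\<close> is exactly what makes one random step unbiased. Given its size \<open>t\<close>, a
uniformly distributed subset of \<open>N\<close> indices contains a fixed index with probability \<open>t / N\<close>
(\<open>card_subsets_containing\<close>), so \<open>\<T>\<^sub>k\<close> contains each index with probability \<open>\<bbbE>[T] / N\<close>
(\<open>inclusion_probability_random_index_set_pmf\<close>); in other words, \<open>\<bbbE>[D\<^bsub>\<T>\<^sub>k\<^esub>] = (\<bbbE>[T] / N) I\<close>.

The iterate \<open>x\<^sub>k\<^sub>-\<^sub>1\<close> is a function of the first \<open>k - 1\<close> selections only, so it is independent
of \<open>\<T>\<^sub>k\<close>. Hence the expectation of the product \<open>D\<^bsub>\<T>\<^sub>k\<^esub> A x\<^sub>k\<^sub>-\<^sub>1\<close> factors, coordinate by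
coordinate, into \<open>(\<bbbE>[T] / N) A \<bbbE>[x\<^sub>k\<^sub>-\<^sub>1]\<close> (\<open>integral_index_selection_mult_vec\<close>). After
scaling, \<open>\<bbbE>[x\<^sub>k] = A \<bbbE>[x\<^sub>k\<^sub>-\<^sub>1]\<close>, and induction on \<open>k\<close> gives the claim. The same product
structure yields integrability. To make the dependence on the past usable, the iterate is written
as an explicit measurable function of the whole path of selections (\<open>selection_iterate\<close>).
\<close>

section \<open>Uniform index sets of uniformly distributed size\<close>

lemma card_subsets_of_card:
  "card {S :: 'n::finite set. card S = t} = CARD('n) choose t"
  using n_subsets[of "UNIV :: 'n set" t] by simp

lemma expectation_random_index_set_pmf:
  fixes f :: "nat \<times> 'n::finite set \<Rightarrow> real"
  assumes "g1 \<le> g2" "g2 \<le> CARD('n)"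
  shows "measure_pmf.expectation (random_index_set_pmf g1 g2) f
    = (\<Sum>t\<in>{g1..g2}. (\<Sum>S | card S = t. f (t, S)) / (CARD('n) choose t)) / card {g1..g2}"
proof -
  have nonempty: "{S :: 'n set. card S = t} \<noteq> {}" if "t \<in> {g1..g2}" for t
  proof -
    have "0 < card {S :: 'n set. card S = t}"
      unfolding card_subsets_of_card using that assms by (intro zero_less_binomial) auto
    then show ?thesis by fastforce
  qed
  have "measure_pmf.expectation (random_index_set_pmf g1 g2) f
      = (\<Sum>t\<in>{g1..g2}. measure_pmf.expectation
            (pmf_of_set {S. card S = t} \<bind> (\<lambda>S. return_pmf (t, S))) f /\<^sub>R card {g1..g2})"
    unfolding random_index_set_pmf_def
  proof (rule pmf_expectation_bind_pmf_of_set)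
    fix t assume "t \<in> {g1..g2}"
    show "finite (set_pmf (pmf_of_set {S :: 'n set. card S = t} \<bind> (\<lambda>S. return_pmf (t, S))))"
      by (simp add: set_pmf_of_set[OF nonempty[OF \<open>t \<in> {g1..g2}\<close>]])
  qed (use assms in auto)
  also have "\<dots> = (\<Sum>t\<in>{g1..g2}. (\<Sum>S | card S = t. f (t, S)) / (CARD('n) choose t) / card {g1..g2})"
  proof (rule sum.cong[OF refl])
    fix t assume t: "t \<in> {g1..g2}"
    have "measure_pmf.expectation (pmf_of_set {S. card S = t} \<bind> (\<lambda>S. return_pmf (t, S))) f
        = (\<Sum>S | card S = t. measure_pmf.expectation (return_pmf (t, S)) f /\<^sub>R card {S :: 'n set. card S = t})"
      by (rule pmf_expectation_bind_pmf_of_set[OF nonempty[OF t]]) auto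
    then show "measure_pmf.expectation
            (pmf_of_set {S. card S = t} \<bind> (\<lambda>S. return_pmf (t, S))) f /\<^sub>R card {g1..g2}
        = (\<Sum>S | card S = t. f (t, S)) / (CARD('n) choose t) / card {g1..g2}"
      by (simp add: card_subsets_of_card divide_inverse sum_distrib_left mult_ac)
  qed
  finally show ?thesis
    by (simp add: sum_divide_distrib)
qed

lemma mean_set_size_random_index_set_pmf:
  assumes "g1 \<le> g2" "g2 \<le> CARD('n::finite)"
  shows "mean_set_size (random_index_set_pmf g1 g2 :: (nat \<times> 'n set) pmf)
    = (\<Sum>t\<in>{g1..g2}. real t) / card {g1..g2}"
proof -
  have "(\<Sum>S :: 'n set | card S = t. real t) / (CARD('n) choose t) = real t" if "t \<in> {g1..g2}" for t
    using that assms by (simp add: card_subsets_of_card)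
  then show ?thesis
    unfolding mean_set_size_def by (subst expectation_random_index_set_pmf[OF assms]) simp
qed

text \<open>
A \<open>t\<close>-element subset containing \<open>i\<close> is a \<open>(t - 1)\<close>-element subset of the other indices with \<open>i\<close>
inserted, so the claim is the absorption identity \<open>N (N - 1 choose t - 1) = t (N choose t)\<close>.
\<close>

lemma card_subsets_containing:
  fixes i :: "'n::finite"
  shows "CARD('n) * card {S. card S = t \<and> i \<in> S} = t * (CARD('n) choose t)"
proof (cases t)
  case 0
  then show ?thesis by auto
next
  case (Suc m)
  have "bij_betw (insert i) {S. S \<subseteq> - {i} \<and> card S = m} {S. card S = t \<and> i \<in> S}"
  proof (rule bij_betwI[where g = "\<lambda>S. S - {i}"])
    show "insert i \<in> {S. S \<subseteq> - {i} \<and> card S = m} \<rightarrow> {S. card S = t \<and> i \<in> S}"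
      by (auto simp: Suc card_insert_if)
    show "(\<lambda>S. S - {i}) \<in> {S. card S = t \<and> i \<in> S} \<rightarrow> {S. S \<subseteq> - {i} \<and> card S = m}"
      by (auto simp: Suc)
  qed auto
  then have "card {S. card S = t \<and> i \<in> S} = card {S. S \<subseteq> - {i} \<and> card S = m}"
    by (simp add: bij_betw_same_card)
  also have "\<dots> = (CARD('n) - 1) choose m"
    using n_subsets[of "- {i}" m] by (simp add: Compl_eq_Diff_UNIV)
  finally show ?thesis
    using Suc_times_binomial_eq[of "CARD('n) - 1" m] by (simp add: Suc mult.commute)
qed

lemma inclusion_probability_random_index_set_pmf:
  fixes i :: "'n::finite"
  assumes "g1 \<le> g2" "g2 \<le> CARD('n)"
  shows "measure_pmf.expectation (random_index_set_pmf g1 g2) (\<lambda>(t, S). indicator S i)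
    = mean_set_size (random_index_set_pmf g1 g2 :: (nat \<times> 'n set) pmf) / CARD('n)"
proof -
  have fibre: "(\<Sum>S | card S = t. indicator S i :: real) / (CARD('n) choose t) = real t / CARD('n)"
    if "t \<in> {g1..g2}" for t
  proof -
    have "(\<Sum>S | card S = t. indicator S i :: real) = real (card {S. card S = t \<and> i \<in> S})"
      by (simp add: indicator_def sum.If_cases Int_def)
    moreover have "real CARD('n) * real (card {S. card S = t \<and> i \<in> S}) = real t * real (CARD('n) choose t)"
      using card_subsets_containing[of t i] by (metis of_nat_mult)
    moreover have "0 < CARD('n) choose t"
      using that assms by (intro zero_less_binomial) auto
    ultimately show ?thesis
      by (simp add: field_simps)
  qed
  have "measure_pmf.expectation (random_index_set_pmf g1 g2) (\<lambda>(t, S). indicator S i)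
      = (\<Sum>t\<in>{g1..g2}. real t / CARD('n)) / card {g1..g2}"
    by (subst expectation_random_index_set_pmf[OF assms]) (simp add: fibre)
  then show ?thesis
    by (simp add: mean_set_size_random_index_set_pmf[OF assms] sum_divide_distrib mult.commute)
qed

section \<open>Expectation of one random selection step\<close>

text \<open>
Multiplying by the selection matrix scales each coordinate by a random indicator; this form reduces
expectations of \<open>D\<^sub>S y\<close> to expectations of products of real random variables.
\<close>

lemma index_selection_mult_vec:
  "index_selection S *v y = (\<Sum>i\<in>UNIV. (indicator S i * y $ i) *\<^sub>R axis i 1)"
proof -
  have entry: "index_selection S $ a $ b = (if a = b \<and> a \<in> S then 1 else 0)" for a b
  proof -
    have "index_selection S $ a $ b = (\<Sum>i\<in>S. axis i 1 $ a * axis i 1 $ b)"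
      by (simp add: index_selection_def matrix_matrix_mult_def columnvector_def rowvector_def)
    also have "\<dots> = (\<Sum>i\<in>S. if i = a then (if a = b then 1 else 0) else 0)"
      by (rule sum.cong) (auto simp: axis_def)
    finally show ?thesis
      by (simp add: sum.delta)
  qed
  show ?thesis
  proof (rule vec_eq_iff[THEN iffD2], intro allI)
    fix a
    have "(index_selection S *v y) $ a = (\<Sum>b\<in>UNIV. if b = a then indicator S a * y $ a else 0)"
      unfolding matrix_vector_mult_def vec_lambda_beta
      by (rule sum.cong) (auto simp: entry)
    moreover have "(\<Sum>i\<in>UNIV. (indicator S i * y $ i) *\<^sub>R axis i 1) $ a
        = (\<Sum>i\<in>UNIV. if i = a then indicator S a * y $ a else 0)"
      unfolding sum_component by (rule sum.cong) (auto simp: axis_def)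
    ultimately show "(index_selection S *v y) $ a
        = (\<Sum>i\<in>UNIV. (indicator S i * y $ i) *\<^sub>R axis i 1) $ a"
      by simp
  qed
qed

lemma (in prob_space) integral_index_selection_mult_vec:
  fixes Y :: "'a \<Rightarrow> real^'n" and S :: "'a \<Rightarrow> 'n set"
  assumes indep: "\<And>i. indep_var borel (\<lambda>\<omega>. indicator (S \<omega>) i :: real) borel (\<lambda>\<omega>. Y \<omega> $ i)"
    and S: "\<And>i. integrable M (\<lambda>\<omega>. indicator (S \<omega>) i :: real)"
    and Y: "integrable M Y"
    and q: "\<And>i. expectation (\<lambda>\<omega>. indicator (S \<omega>) i) = q"
  shows "integrable M (\<lambda>\<omega>. index_selection (S \<omega>) *v Y \<omega>)"
    and "(\<integral>\<omega>. index_selection (S \<omega>) *v Y \<omega> \<partial>M) = q *\<^sub>R (\<integral>\<omega>. Y \<omega> \<partial>M)"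
proof -
  have Yi: "integrable M (\<lambda>\<omega>. Y \<omega> $ i)" and EYi: "(\<integral>\<omega>. Y \<omega> $ i \<partial>M) = (\<integral>\<omega>. Y \<omega> \<partial>M) $ i" for i
    using integrable_bounded_linear[OF bounded_linear_vec_nth Y]
      integral_bounded_linear[OF bounded_linear_vec_nth Y] by simp_all
  have prod: "integrable M (\<lambda>\<omega>. indicator (S \<omega>) i * Y \<omega> $ i)" for i
    by (rule indep_var_integrable[OF indep S Yi])
  have Eprod: "(\<integral>\<omega>. indicator (S \<omega>) i * Y \<omega> $ i \<partial>M) = q * (\<integral>\<omega>. Y \<omega> \<partial>M) $ i" for i
    by (simp add: indep_var_lebesgue_integral[OF indep S Yi] q EYi)
  have coord: "integrable M (\<lambda>\<omega>. (indicator (S \<omega>) i * Y \<omega> $ i) *\<^sub>R (axis i 1 :: real^'n))" for i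
    by (intro integrable_scaleR_left prod)
  show "integrable M (\<lambda>\<omega>. index_selection (S \<omega>) *v Y \<omega>)"
    unfolding index_selection_mult_vec by (rule Bochner_Integration.integrable_sum) (rule coord)
  have "(\<integral>\<omega>. index_selection (S \<omega>) *v Y \<omega> \<partial>M)
      = (\<Sum>i\<in>UNIV. \<integral>\<omega>. (indicator (S \<omega>) i * Y \<omega> $ i) *\<^sub>R axis i 1 \<partial>M)"
    unfolding index_selection_mult_vec by (rule Bochner_Integration.integral_sum) (rule coord)
  also have "\<dots> = (\<Sum>i\<in>UNIV. (q * (\<integral>\<omega>. Y \<omega> \<partial>M) $ i) *\<^sub>R axis i 1)"
    by (simp add: prod Eprod)
  also have "\<dots> = q *\<^sub>R (\<integral>\<omega>. Y \<omega> \<partial>M)"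
    by (simp add: vec_eq_iff axis_def if_distrib cong: if_cong)
  finally show "(\<integral>\<omega>. index_selection (S \<omega>) *v Y \<omega> \<partial>M) = q *\<^sub>R (\<integral>\<omega>. Y \<omega> \<partial>M)" .
qed

section \<open>The iterate as a function of the path of selections\<close>

text \<open>
The argument \<open>z\<close> is one outcome of the whole sequence of pairs \<open>(T\<^sub>k, \<T>\<^sub>k)\<close>, indexed from 1. It is a
total sequence rather than a list of the first \<open>k\<close> pairs so that the function is defined on
every product space over an index set containing \<open>{1..k}\<close>.
\<close>

primrec selection_iterate ::
  "real \<Rightarrow> real^'n^'n \<Rightarrow> real^'n \<Rightarrow> nat \<Rightarrow> (nat \<Rightarrow> nat \<times> 'n set) \<Rightarrow> real^'n" where
  "selection_iterate c A y 0 z = y"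
| "selection_iterate c A y (Suc k) z
    = c *\<^sub>R (index_selection (snd (z (Suc k))) *v (A *v selection_iterate c A y k z))"

lemma selection_iterate_cong:
  assumes "\<And>j. j \<in> {1..k} \<Longrightarrow> z j = z' j"
  shows "selection_iterate c A y k z = selection_iterate c A y k z'"
  using assms by (induction k) simp_all

lemma selection_iterate_measurable:
  assumes "{1..k} \<subseteq> I"
  shows "selection_iterate c A y k \<in> borel_measurable (PiM I (\<lambda>_. count_space UNIV))"
  using assms
proof (induction k)
  case 0
  then show ?case by (simp add: selection_iterate.simps(1)[abs_def])
next
  case (Suc k)
  have "(\<lambda>z. z (Suc k)) \<in> measurable (PiM I (\<lambda>_. count_space (UNIV :: (nat \<times> 'a set) set))) (count_space UNIV)"
    using Suc.prems by (intro measurable_component_singleton) auto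
  then have sel: "(\<lambda>z. indicator (snd (z (Suc k))) i :: real)
      \<in> borel_measurable (PiM I (\<lambda>_. count_space (UNIV :: (nat \<times> 'a set) set)))" for i
    by (rule measurable_compose) simp
  have lin: "(\<lambda>u :: real^'a. (A *v u) $ i) \<in> borel_measurable borel" for i
    by (intro borel_measurable_continuous_onI continuous_intros)
  have "selection_iterate c A y k \<in> borel_measurable (PiM I (\<lambda>_. count_space UNIV))"
    using Suc.prems by (intro Suc.IH) auto
  from measurable_compose[OF this lin] sel show ?case
    unfolding selection_iterate.simps(2)[abs_def] index_selection_mult_vec
    by measurable
qed

text \<open>
Each step multiplies the expectation by \<open>c q A = A\<close>, where \<open>q\<close> is the common inclusion probability of
the indices: \<open>Y\<close> below depends on the first \<open>m\<close> selections only, hence is independent of selection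
\<open>Suc m\<close>. This takes joint independence of the selections; pairwise independence would not
separate the next selection from the whole past.
\<close>

lemma (in prob_space) expectation_selection_iterate:
  fixes Z :: "nat \<Rightarrow> 'a \<Rightarrow> nat \<times> 'n::finite set"
  assumes indep: "indep_vars (\<lambda>_. count_space UNIV) Z {1..}"
    and q: "\<And>j i. j \<ge> 1 \<Longrightarrow> expectation (\<lambda>\<omega>. indicator (snd (Z j \<omega>)) i) = q"
    and unbiased: "c * q = 1"
  shows "integrable M (\<lambda>\<omega>. selection_iterate c A y k (\<lambda>j. Z j \<omega>))
    \<and> expectation (\<lambda>\<omega>. selection_iterate c A y k (\<lambda>j. Z j \<omega>)) = matrix_power A k *v y"
proof (induction k)
  case 0
  then show ?case by (simp add: prob_space)
next
  case (Suc m)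
  let ?C = "count_space (UNIV :: (nat \<times> 'n set) set)"
  let ?S = "\<lambda>\<omega>. snd (Z (Suc m) \<omega>)"
  define Y where "Y \<omega> = A *v selection_iterate c A y m (\<lambda>j. Z j \<omega>)" for \<omega>
  have Z_meas: "Z (Suc m) \<in> measurable M ?C"
    using indep by (auto simp: indep_vars_def)
  have "(\<lambda>\<omega>. indicator (?S \<omega>) i :: real) \<in> borel_measurable M" for i
    by (rule measurable_compose[OF Z_meas]) simp
  then have S: "integrable M (\<lambda>\<omega>. indicator (?S \<omega>) i :: real)" for i
    by (intro integrable_const_bound[where B = 1]) (auto simp: indicator_def)
  have A_linear: "bounded_linear ((*v) A)"
    by (rule matrix_vector_mul_bounded_linear)
  have Y: "integrable M Y" and EY: "expectation Y = matrix_power A (Suc m) *v y"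
    unfolding Y_def[abs_def]
    using integrable_bounded_linear[OF A_linear conjunct1[OF Suc.IH]]
      integral_bounded_linear[OF A_linear conjunct1[OF Suc.IH]] Suc.IH
    by (simp_all add: matrix_vector_mul_assoc[symmetric])
  have past_indep: "indep_var borel (\<lambda>\<omega>. indicator (?S \<omega>) i :: real) borel (\<lambda>\<omega>. Y \<omega> $ i)" for i
  proof -
    let ?u = "\<lambda>z :: nat \<Rightarrow> nat \<times> 'n set. indicator (snd (z (Suc m))) i :: real"
    let ?w = "\<lambda>z. (A *v selection_iterate c A y m z) $ i"
    have "indep_var (PiM {Suc m} (\<lambda>_. ?C)) (\<lambda>\<omega>. \<lambda>j\<in>{Suc m}. Z j \<omega>)
        (PiM {1..m} (\<lambda>_. ?C)) (\<lambda>\<omega>. \<lambda>j\<in>{1..m}. Z j \<omega>)"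
      by (rule indep_var_restrict[OF indep]) auto
    moreover have "?u \<in> borel_measurable (PiM {Suc m} (\<lambda>_. ?C))"
      by (rule measurable_compose[OF measurable_component_singleton]) auto
    moreover have "?w \<in> borel_measurable (PiM {1..m} (\<lambda>_. ?C))"
      by (rule measurable_compose[OF selection_iterate_measurable])
        (auto intro!: borel_measurable_continuous_onI continuous_intros)
    ultimately have "indep_var borel (?u \<circ> (\<lambda>\<omega>. \<lambda>j\<in>{Suc m}. Z j \<omega>))
        borel (?w \<circ> (\<lambda>\<omega>. \<lambda>j\<in>{1..m}. Z j \<omega>))"
      by (rule indep_var_compose)
    moreover have "?w \<circ> (\<lambda>\<omega>. \<lambda>j\<in>{1..m}. Z j \<omega>) = (\<lambda>\<omega>. Y \<omega> $ i)"
    proof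
      fix \<omega>
      have "selection_iterate c A y m (\<lambda>j\<in>{1..m}. Z j \<omega>) = selection_iterate c A y m (\<lambda>j. Z j \<omega>)"
        by (rule selection_iterate_cong) simp
      then show "(?w \<circ> (\<lambda>\<omega>. \<lambda>j\<in>{1..m}. Z j \<omega>)) \<omega> = Y \<omega> $ i"
        by (simp add: Y_def)
    qed
    ultimately show ?thesis
      by (simp add: o_def)
  qed
  have "integrable M (\<lambda>\<omega>. index_selection (?S \<omega>) *v Y \<omega>)"
    "expectation (\<lambda>\<omega>. index_selection (?S \<omega>) *v Y \<omega>) = q *\<^sub>R expectation Y"
    by (rule integral_index_selection_mult_vec[OF past_indep S Y q]; simp)+
  then show ?case
    using unbiased by (simp add: Y_def[symmetric] EY)
qed

section \<open>The random iteration is unbiased\<close>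

theorem proposition2:
  fixes M :: "'w measure"
    and A :: "real^'n^'n"
    and \<mu> :: "nat \<Rightarrow> real"
    and v :: "nat \<Rightarrow> real^'n"
    and \<gamma>\<^sub>1 \<gamma>\<^sub>2 :: nat
    and T :: "nat \<Rightarrow> 'w \<Rightarrow> nat"
    and \<T> :: "nat \<Rightarrow> 'w \<Rightarrow> 'n set"
    and x\<^sub>0 :: "real^'n"
    and x :: "nat \<Rightarrow> 'w \<Rightarrow> real^'n"
    and k :: nat
  assumes prob: "prob_space M"
    and symmetric: "transpose A = A"
    and eigenpairs: "\<And>j. j \<in> {1..CARD('n)} \<Longrightarrow> A *v v j = \<mu> j *\<^sub>R v j"
    and orthonormal: "\<And>i j. i \<in> {1..CARD('n)} \<Longrightarrow> j \<in> {1..CARD('n)} \<Longrightarrow>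
          v i \<bullet> v j = (if i = j then 1 else 0)"
    and eigenvalue_1: "\<mu> 1 = 1"
    and spectral_gap: "2 \<le> CARD('n) \<Longrightarrow> \<bar>\<mu> 2\<bar> < \<mu> 1"
    and eigenvalues_decreasing: "\<And>i j. 2 \<le> i \<Longrightarrow> i \<le> j \<Longrightarrow> j \<le> CARD('n) \<Longrightarrow> \<bar>\<mu> j\<bar> \<le> \<bar>\<mu> i\<bar>"
    and bounds: "1 \<le> \<gamma>\<^sub>1" "\<gamma>\<^sub>1 \<le> \<gamma>\<^sub>2" "\<gamma>\<^sub>2 \<le> CARD('n)"
    and indep: "prob_space.indep_vars M (\<lambda>_. count_space UNIV) (\<lambda>k \<omega>. (T k \<omega>, \<T> k \<omega>)) {1..}"
    and law: "\<And>k. k \<ge> 1 \<Longrightarrow>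
          distr M (count_space UNIV) (\<lambda>\<omega>. (T k \<omega>, \<T> k \<omega>))
            = measure_pmf (random_index_set_pmf \<gamma>\<^sub>1 \<gamma>\<^sub>2)"
    and initial_nonzero: "x\<^sub>0 \<bullet> v 1 \<noteq> 0"
    and initial: "\<And>\<omega>. \<omega> \<in> space M \<Longrightarrow> x 0 \<omega> = x\<^sub>0"
    and update: "\<And>k \<omega>. k \<ge> 1 \<Longrightarrow> \<omega> \<in> space M \<Longrightarrow>
          x k \<omega> = (real CARD('n) / mean_set_size (random_index_set_pmf \<gamma>\<^sub>1 \<gamma>\<^sub>2 :: (nat \<times> 'n set) pmf))
                    *\<^sub>R (index_selection (\<T> k \<omega>) *v (A *v x (k - 1) \<omega>))"
    and k: "k \<ge> 1"
  shows "integrable M (x k) \<and> integral\<^sup>L M (x k) = matrix_power A k *v x\<^sub>0"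
proof -
  interpret prob_space M by (rule prob)
  let ?p = "random_index_set_pmf \<gamma>\<^sub>1 \<gamma>\<^sub>2 :: (nat \<times> 'n set) pmf"
  let ?C = "count_space (UNIV :: (nat \<times> 'n set) set)"
  define Z where "Z k \<omega> = (T k \<omega>, \<T> k \<omega>)" for k \<omega>
  define c where "c = real CARD('n) / mean_set_size ?p"
  have Z_indep: "indep_vars (\<lambda>_. ?C) Z {1..}"
    using indep by (simp add: Z_def[abs_def])
  have "0 < (\<Sum>t\<in>{\<gamma>\<^sub>1..\<gamma>\<^sub>2}. real t)"
    using bounds by (intro sum_pos) auto
  then have "0 < mean_set_size ?p"
    using bounds by (simp add: mean_set_size_random_index_set_pmf)
  then have unbiased: "c * (mean_set_size ?p / CARD('n)) = 1"
    by (simp add: c_def)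
  have inclusion: "expectation (\<lambda>\<omega>. indicator (snd (Z j \<omega>)) i) = mean_set_size ?p / CARD('n)"
    if "j \<ge> 1" for i j
  proof -
    have Z_meas: "Z j \<in> measurable M ?C"
      using Z_indep that by (auto simp: indep_vars_def)
    have "expectation (\<lambda>\<omega>. indicator (snd (Z j \<omega>)) i :: real) = (\<integral>z. indicator (snd z) i \<partial>distr M ?C (Z j))"
      by (rule integral_distr[symmetric, OF Z_meas]) simp
    also have "distr M ?C (Z j) = measure_pmf ?p"
      using law[OF that] by (simp add: Z_def[abs_def])
    also have "(\<integral>z. indicator (snd z) i \<partial>measure_pmf ?p) = mean_set_size ?p / CARD('n)"
      using inclusion_probability_random_index_set_pmf[OF bounds(2,3), of i]
      by (simp add: case_prod_unfold)
    finally show ?thesis .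
  qed
  have path: "x j \<omega> = selection_iterate c A x\<^sub>0 j (\<lambda>l. Z l \<omega>)" if "\<omega> \<in> space M" for j \<omega>
    by (induction j) (simp_all add: that initial update Z_def c_def)
  (* The recursion determines x only on space M, so the two functions may differ outside it. *)
  have "integrable M (x k) \<longleftrightarrow> integrable M (\<lambda>\<omega>. selection_iterate c A x\<^sub>0 k (\<lambda>l. Z l \<omega>))"
    by (rule Bochner_Integration.integrable_cong[OF refl path])
  moreover have "integral\<^sup>L M (x k) = expectation (\<lambda>\<omega>. selection_iterate c A x\<^sub>0 k (\<lambda>l. Z l \<omega>))"
    by (rule Bochner_Integration.integral_cong[OF refl path])
  ultimately show ?thesis
    using expectation_selection_iterate[OF Z_indep inclusion unbiased, of A x\<^sub>0 k] by simp
qed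

end
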